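(* Let $\mathcal{F}$ be a real separable Hilbert space, let $\Phi:\mathcal{F}\to(-\infty,\infty]$ be a Legendre-type generator with $\mathcal{A}=\operatorname{int}(\operatorname{dom}\Phi)$ and convex conjugate $\Phi^\ast$, let $\mathcal{U}\subset\mathcal{A}$ be a nonempty open convex set, and let $V=\nabla\Phi(\mathcal{U})$. Let $F$ be an $\mathcal{F}$-valued random element such that $\mathbb{P}(F\in\mathcal{U})=1$, and assume that $Z=\nabla\Phi(F)$ is Bochner integrable with Bochner mean $\bar z=\mathbb{E}[Z]\in V$. Then the problem $\arg\min_{g\in\mathcal{U}}\mathbb{E}[d_\Phi(g,F)]$ admits a unique minimiser on $\mathcal{U}$, given by $$g^\star=\nabla\Phi^\ast(\bar z)=(\nabla\Phi)^{-1}\bigl(\mathbb{E}[\nabla\Phi(F)]\bigr)=\arg\min_{g\in\mathcal{U}}\ \mathbb{E}\bigl[d_\Phi(g,F)\bigr].$$ In particular, $g^\star$ is the quasi-arithmetic mean of $F$ associated with the transform $\nabla\Phi$.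
   Context: A function $\Phi:\mathcal{F}\to(-\infty,\infty]$ on a real Hilbert space $\mathcal{F}$ (of real-valued functions on a set $\mathcal{X}\subseteq\mathbb{R}^d$) is called a generator if it is proper, lower semicontinuous, strictly convex, and Fréchet differentiable on $\mathcal{A}=\operatorname{int}(\operatorname{dom}\Phi)\neq\emptyset$. Throughout, $\nabla$ denotes the Fréchet gradient, i.e. the Riesz representer in $\mathcal{F}$ of the Fréchet derivative. The functional Bregman divergence generated by $\Phi$ is, for $f,g\in\mathcal{A}$, $d_\Phi(f,g)=\Phi(f)-\Phi(g)-\langle\nabla\Phi(g),f-g\rangle_{\mathcal{F}}$. A generator is of Legendre type if it is additionally essentially smooth ($\partial\Phi$ is locally bounded and single-valued on its domain) and essentially strictly convex ($(\partial\Phi)^{-1}$ is locally bounded on its domain and $\Phi$ is strictly convex on every convex subset of $\operatorname{dom}\partial\Phi$). The dual of $\mathcal{F}$ is identified with $\mathcal{F}$ via the Riesz representation, and $\Phi^\ast(u)=\sup_{f\in\mathcal{F}}\{\langle u,f\rangle_{\mathcal{F}}-\Phi(f)\}$. A random element of $\mathcal{F}$ is a measurable map from a probability space into $\mathcal{F}$ with its Borel $\sigma$-algebra; its Bochner mean is its Bochner integral with respect to $\mathbb{P}$. The quasi-arithmetic mean of $F$ associated with $\nabla\Phi$ is $(\nabla\Phi)^{-1}(\mathbb{E}[\nabla\Phi(F)])$.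
   Formalization: Uniqueness of the minimiser is claimed only when the expected divergence is finite at some g in U (else all g tie at infinity); ∇Φ*(z̄) is the Gateaux gradient, and equals the Fréchet gradient whenever Φ* is Fréchet differentiable at z̄, which can fail in infinite dimension. *)

theory Defs
  imports "HOL-Probability.Probability"
begin

definition dom_fun :: "('a \<Rightarrow> ereal) \<Rightarrow> 'a set" where
  "dom_fun \<Phi> = {x. \<Phi> x < \<infinity>}"

definition proper_fun :: "('a \<Rightarrow> ereal) \<Rightarrow> bool" where
  "proper_fun \<Phi> \<longleftrightarrow> (\<forall>x. \<Phi> x \<noteq> -\<infinity>) \<and> dom_fun \<Phi> \<noteq> {}"

definition lower_semicontinuous :: "('a::topological_space \<Rightarrow> ereal) \<Rightarrow> bool" where
  "lower_semicontinuous \<Phi> \<longleftrightarrow> (\<forall>x. \<Phi> x \<le> Liminf (at x) \<Phi>)"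

definition strictly_convex_on :: "'a::real_vector set \<Rightarrow> ('a \<Rightarrow> ereal) \<Rightarrow> bool" where
  "strictly_convex_on C \<Phi> \<longleftrightarrow>
     (\<forall>x\<in>C. \<forall>y\<in>C. \<forall>t::real. x \<noteq> y \<longrightarrow> 0 < t \<longrightarrow> t < 1 \<longrightarrow>
        \<Phi> ((1 - t) *\<^sub>R x + t *\<^sub>R y) < ereal (1 - t) * \<Phi> x + ereal t * \<Phi> y)"

text \<open>Strict convexity is required on the effective domain only: where \<open>\<Phi>\<close> takes the value
  \<open>\<infinity>\<close>, the strict inequality would fail for trivial reasons. It implies that the
  effective domain is convex.\<close>

definition generator :: "('a::real_inner \<Rightarrow> ereal) \<Rightarrow> bool" where
  "generator \<Phi> \<longleftrightarrow>
     proper_fun \<Phi> \<and> lower_semicontinuous \<Phi> \<and> strictly_convex_on (dom_fun \<Phi>) \<Phi> \<and>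
     interior (dom_fun \<Phi>) \<noteq> {} \<and>
     (\<forall>x\<in>interior (dom_fun \<Phi>). (\<lambda>y. real_of_ereal (\<Phi> y)) differentiable (at x))"

text \<open>The Riesz representer of the Frechet derivative. It is set to \<open>0\<close> off the
  interior of the effective domain, so that for a generator \<open>\<Phi>\<close> the map \<open>grad \<Phi>\<close> is Borel
  measurable on the whole space: values of a random element on a null set outside the interior
  then impose no spurious measurability condition.\<close>

definition grad :: "('a::real_inner \<Rightarrow> ereal) \<Rightarrow> 'a \<Rightarrow> 'a" where
  "grad \<Phi> x =
     (if x \<in> interior (dom_fun \<Phi>) then (THE D. GDERIV (\<lambda>y. real_of_ereal (\<Phi> y)) x :> D) else 0)"

definition has_gateaux_gradient :: "('a::real_inner \<Rightarrow> ereal) \<Rightarrow> 'a \<Rightarrow> 'a \<Rightarrow> bool" where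
  "has_gateaux_gradient f x D \<longleftrightarrow>
     x \<in> interior {y. \<bar>f y\<bar> \<noteq> \<infinity>} \<and>
     (\<forall>h. ((\<lambda>t::real. real_of_ereal (f (x + t *\<^sub>R h))) has_real_derivative (D \<bullet> h)) (at 0))"

text \<open>Set-valued maps are functions \<open>'a \<Rightarrow> 'b set\<close>.\<close>

definition sv_dom :: "('a \<Rightarrow> 'b set) \<Rightarrow> 'a set" where
  "sv_dom T = {x. T x \<noteq> {}}"

definition sv_inverse :: "('a \<Rightarrow> 'b set) \<Rightarrow> 'b \<Rightarrow> 'a set" where
  "sv_inverse T u = {x. u \<in> T x}"

definition sv_single_valued :: "('a \<Rightarrow> 'b set) \<Rightarrow> bool" where
  "sv_single_valued T \<longleftrightarrow> (\<forall>x\<in>sv_dom T. \<exists>u. T x = {u})"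

definition sv_locally_bounded ::
    "('a::real_normed_vector \<Rightarrow> 'b::real_normed_vector set) \<Rightarrow> bool" where
  "sv_locally_bounded T \<longleftrightarrow> (\<forall>x\<in>sv_dom T. \<exists>r>0. bounded (\<Union>y\<in>ball x r. T y))"

definition subdifferential :: "('a::real_inner \<Rightarrow> ereal) \<Rightarrow> 'a \<Rightarrow> 'a set" where
  "subdifferential \<Phi> x =
     {u. x \<in> dom_fun \<Phi> \<and> (\<forall>y. \<Phi> x + ereal (u \<bullet> (y - x)) \<le> \<Phi> y)}"

definition essentially_smooth :: "('a::real_inner \<Rightarrow> ereal) \<Rightarrow> bool" where
  "essentially_smooth \<Phi> \<longleftrightarrow>
     sv_locally_bounded (subdifferential \<Phi>) \<and> sv_single_valued (subdifferential \<Phi>)"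

definition essentially_strictly_convex :: "('a::real_inner \<Rightarrow> ereal) \<Rightarrow> bool" where
  "essentially_strictly_convex \<Phi> \<longleftrightarrow>
     sv_locally_bounded (sv_inverse (subdifferential \<Phi>)) \<and>
     (\<forall>C. convex C \<longrightarrow> C \<subseteq> sv_dom (subdifferential \<Phi>) \<longrightarrow> strictly_convex_on C \<Phi>)"

definition legendre_generator :: "('a::real_inner \<Rightarrow> ereal) \<Rightarrow> bool" where
  "legendre_generator \<Phi> \<longleftrightarrow>
     generator \<Phi> \<and> essentially_smooth \<Phi> \<and> essentially_strictly_convex \<Phi>"

definition convex_conjugate :: "('a::real_inner \<Rightarrow> ereal) \<Rightarrow> 'a \<Rightarrow> ereal" where
  "convex_conjugate \<Phi> u = (SUP f. ereal (u \<bullet> f) - \<Phi> f)"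

definition bregman :: "('a::real_inner \<Rightarrow> ereal) \<Rightarrow> 'a \<Rightarrow> 'a \<Rightarrow> real" where
  "bregman \<Phi> f g = real_of_ereal (\<Phi> f) - real_of_ereal (\<Phi> g) - grad \<Phi> g \<bullet> (f - g)"

text \<open>The expectation of \<open>bregman \<Phi> g (F \<omega>)\<close> as an element of \<open>[0, \<infinity>]\<close>. For a generator
  \<open>\<Phi>\<close> the divergence of two points of the interior of the effective domain is nonnegative (gradient
  inequality), so \<open>ennreal\<close> truncates nothing, up to a null set, when \<open>F\<close> is almost surely in
  that interior.\<close>

definition expected_bregman ::
    "'w measure \<Rightarrow> ('a::real_inner \<Rightarrow> ereal) \<Rightarrow> ('w \<Rightarrow> 'a) \<Rightarrow> 'a \<Rightarrow> ennreal" where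
  "expected_bregman M \<Phi> F g = (\<integral>\<^sup>+\<omega>. ennreal (bregman \<Phi> g (F \<omega>)) \<partial>M)"

text \<open>The set \<open>A\<close> is the domain on which the transform \<open>T\<close> is to be inverted.\<close>

definition quasi_arithmetic_mean ::
    "'w measure \<Rightarrow> 'a set \<Rightarrow> ('a \<Rightarrow> 'b::{banach, second_countable_topology}) \<Rightarrow> ('w \<Rightarrow> 'a) \<Rightarrow> 'a" where
  "quasi_arithmetic_mean M A T F = the_inv_into A T (\<integral>\<omega>. T (F \<omega>) \<partial>M)"

end

theory Submission
  imports Defs
begin

text \<open>Write \<open>zbar = \<nabla>\<Phi> g\<close> with \<open>g \<in> U\<close>. Integrating
  \<open>d\<^sub>\<Phi>(f, F) - d\<^sub>\<Phi>(g, F) = \<Phi> f - \<Phi> g - \<nabla>\<Phi> F \<bullet> (f - g)\<close> gives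
  \<open>E d\<^sub>\<Phi>(f, F) = E d\<^sub>\<Phi>(g, F) + d\<^sub>\<Phi>(f, g)\<close>, and \<open>d\<^sub>\<Phi>(f, g) > 0\<close> for
  \<open>f \<noteq> g\<close> by strict convexity.

  The work lies in the conjugate. Local boundedness of \<open>(\<partial>\<Phi>)\<^sup>-\<^sup>1\<close> at \<open>zbar\<close> makes
  \<open>\<Phi>\<^sup>*\<close> bounded above on a ball around \<open>zbar\<close>; hence \<open>\<Phi> - u\<close> is coercive and attains its
  minimum at some \<open>p\<^sub>u\<close> for \<open>u\<close> near \<open>zbar\<close>. As \<open>g\<close> is the only minimiser of
  \<open>\<Phi> - zbar\<close>, the points \<open>p\<^sub>u\<close> tend weakly to \<open>g\<close> as \<open>u \<rightarrow> zbar\<close>, and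
  \<open>0 \<le> \<Phi>\<^sup>* u - \<Phi>\<^sup>* zbar - (u - zbar) \<bullet> g \<le> (u - zbar) \<bullet> (p\<^sub>u - g)\<close> yields the Gateaux
  gradient. Weak compactness enters only as the nonempty intersection of nested bounded closed
  convex sets.\<close>

section \<open>Nested closed convex sets and attained minima\<close>

text \<open>Points of nearly minimal norm in the sets form a Cauchy sequence: were two of them far
  apart, the parallelogram law would give their midpoint, which convexity keeps in the set, too
  small a norm.\<close>

lemma Inter_closed_convex_bounded_nonempty:
  fixes C :: "nat \<Rightarrow> 'a::{real_inner, banach} set"
  assumes closed: "\<And>n. closed (C n)" and convex: "\<And>n. convex (C n)"
    and ne: "\<And>n. C n \<noteq> {}" and dec: "decseq C" and bdd: "bounded (C 0)"
  shows "(\<Inter>n. C n) \<noteq> {}"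
proof -
  obtain B where B: "\<And>x. x \<in> C 0 \<Longrightarrow> norm x \<le> B"
    using bdd by (auto simp: bounded_iff)
  have sub: "C n \<subseteq> C m" if "m \<le> n" for m n
    using dec that by (auto simp: decseq_def)
  define d where "d n = Inf ((\<lambda>x. x \<bullet> x) ` C n)" for n
  have bb: "bdd_below ((\<lambda>x. x \<bullet> x) ` C n)" for n
    by (rule bdd_belowI[of _ 0]) auto
  have d_le: "d n \<le> x \<bullet> x" if "x \<in> C n" for n x
    unfolding d_def using that bb by (intro cInf_lower) auto
  have "\<exists>x\<in>C n. x \<bullet> x < d n + 1 / Suc n" for n
  proof -
    have "\<exists>y\<in>(\<lambda>x. x \<bullet> x) ` C n. y < d n + 1 / Suc n"
      unfolding d_def using ne bb by (subst cInf_less_iff[symmetric]) auto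
    then show ?thesis by auto
  qed
  then obtain f where f: "\<And>n. f n \<in> C n" and fd: "\<And>n. f n \<bullet> f n < d n + 1 / Suc n"
    by metis
  have inc: "incseq d"
    unfolding incseq_def d_def using sub bb ne
    by (intro allI impI cInf_superset_mono) (auto simp: image_mono)
  have dB: "d n \<le> B\<^sup>2" for n
  proof -
    have "d n \<le> f n \<bullet> f n" using f d_le by blast
    also have "\<dots> \<le> B\<^sup>2"
      unfolding power2_norm_eq_inner[symmetric] using B f sub[of 0 n]
      by (intro power_mono) auto
    finally show ?thesis .
  qed
  obtain L where L: "d \<longlonglongrightarrow> L" and dL: "\<And>n. d n \<le> L"
    using incseq_convergent[OF inc, of "B\<^sup>2"] dB by metis
  \<comment> \<open>The parallelogram law bounds the squared distance by
    \<open>2 * (f n \<bullet> f n + f m \<bullet> f m) - 4 * d n\<close>. Inserting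
    \<open>fd\<close> twice and \<open>d m \<le> L\<close> gives \<open>e n\<close>.\<close>
  define e where "e n = 2 * (L - d n) + 4 * (1 / Suc n)" for n
  have e: "e \<longlonglongrightarrow> 2 * (L - L) + 4 * 0"
    unfolding e_def using L LIMSEQ_Suc[OF lim_1_over_n] by (intro tendsto_intros) auto
  have diff: "(norm (f n - f m))\<^sup>2 \<le> e n" if "n \<le> m" for n m
  proof -
    have "(1/2) *\<^sub>R f n + (1/2) *\<^sub>R f m \<in> C n"
      using convex[of n] f[of n] f[of m] sub[OF that] by (auto intro!: convexD)
    from d_le[OF this] have mid: "4 * d n \<le> f n \<bullet> f n + 2 * (f n \<bullet> f m) + f m \<bullet> f m"
      by (simp add: inner_simps inner_commute)
    have "1 / real (Suc m) \<le> 1 / real (Suc n)"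
      using that by (intro divide_left_mono) auto
    then show ?thesis
      using mid fd[of n] fd[of m] dL[of m]
      by (simp add: e_def power2_norm_eq_inner inner_simps inner_commute)
  qed
  have "Cauchy f"
    unfolding Cauchy_altdef
  proof (intro allI impI)
    fix \<epsilon> :: real assume "\<epsilon> > 0"
    then have "eventually (\<lambda>n. e n < \<epsilon>\<^sup>2) sequentially"
      using e by (intro order_tendstoD(2)[OF e]) auto
    then obtain N where N: "\<And>n. n \<ge> N \<Longrightarrow> e n < \<epsilon>\<^sup>2"
      by (auto simp: eventually_sequentially)
    have "dist (f n) (f m) < \<epsilon>" if "n \<ge> N" "m > n" for n m
      using diff[of n m] N[of n] that \<open>\<epsilon> > 0\<close>
      by (intro power_less_imp_less_base[of _ 2 \<epsilon>]) (auto simp: dist_norm)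
    then show "\<exists>M. \<forall>m\<ge>M. \<forall>n>m. dist (f m) (f n) < \<epsilon>" by blast
  qed
  then obtain l where l: "f \<longlonglongrightarrow> l"
    using Cauchy_convergent convergent_def by blast
  have "l \<in> C n" for n
  proof (rule closed_sequentially[OF closed[of n]])
    show "(\<lambda>k. f (k + n)) \<longlonglongrightarrow> l" using l by (rule LIMSEQ_ignore_initial_segment)
    show "f (k + n) \<in> C n" for k using f[of "k + n"] sub[of n "k + n"] by auto
  qed
  then show ?thesis by auto
qed

lemma convex_sublevel:
  assumes "convex_on D f"
  shows "convex {x\<in>D. f x \<le> (c::real)}"
proof (rule convexI)
  fix x y and s t :: real
  assume xy: "x \<in> {x\<in>D. f x \<le> c}" "y \<in> {x\<in>D. f x \<le> c}" and st: "0 \<le> s" "0 \<le> t" "s + t = 1"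
  have s: "s = 1 - t" using st by simp
  have "f (s *\<^sub>R x + t *\<^sub>R y) \<le> s * f x + t * f y"
    unfolding s using convex_onD[OF assms, of t x y] st xy by simp
  also have "\<dots> \<le> c"
    using convex_bound_le[of "f x" c "f y" s t] xy st by simp
  finally show "s *\<^sub>R x + t *\<^sub>R y \<in> {x\<in>D. f x \<le> c}"
    using convexD[OF convex_on_imp_convex[OF assms]] xy st by auto
qed

text \<open>Sublevel sets at decreasing levels are nested, so they share a point. Levels
  \<open>- real n\<close> exclude unboundedness below; levels \<open>m + 1 / Suc n\<close> then
  yield the minimiser.\<close>

lemma attains_min_if_sublevels_bounded:
  fixes f :: "'a::{real_inner, banach} \<Rightarrow> real"
  assumes ne: "D \<noteq> {}"
    and closed: "\<And>c. closed {x\<in>D. f x \<le> c}"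
    and convex: "\<And>c. convex {x\<in>D. f x \<le> c}"
    and bounded: "\<And>c. bounded {x\<in>D. f x \<le> c}"
  shows "\<exists>p\<in>D. \<forall>y\<in>D. f p \<le> f y"
proof -
  have ex: "\<exists>p\<in>D. \<forall>n. f p \<le> c n"
    if dec: "decseq c" and c: "\<And>n. \<exists>x\<in>D. f x \<le> c n" for c :: "nat \<Rightarrow> real"
  proof -
    have "(\<Inter>n. {x\<in>D. f x \<le> c n}) \<noteq> {}"
    proof (rule Inter_closed_convex_bounded_nonempty[OF closed convex _ _ bounded])
      show "decseq (\<lambda>n. {x\<in>D. f x \<le> c n})"
        using dec by (force simp: decseq_def)
    qed (use c in auto)
    then show ?thesis by auto
  qed
  have bdd: "bdd_below (f ` D)"
  proof (rule ccontr)
    assume "\<not> bdd_below (f ` D)"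
    then have "\<exists>x\<in>D. f x \<le> - real n" for n
      by (force simp: bdd_below_def not_le intro: less_imp_le)
    then have "\<exists>p\<in>D. \<forall>n. f p \<le> - real n"
      by (intro ex) (auto simp: decseq_def)
    then obtain p where "\<And>n. f p \<le> - real n" by blast
    then show False
      using reals_Archimedean2[of "- f p"] by (smt (verit))
  qed
  define m where "m = Inf (f ` D)"
  have "\<exists>x\<in>D. f x \<le> m + 1 / Suc n" for n
  proof -
    have "\<exists>y\<in>f ` D. y < m + 1 / Suc n"
      unfolding m_def using ne bdd by (subst cInf_less_iff[symmetric]) auto
    then show ?thesis by (auto intro: less_imp_le)
  qed
  then have "\<exists>p\<in>D. \<forall>n. f p \<le> m + 1 / Suc n"
    by (intro ex) (auto simp: decseq_def frac_le)
  then obtain p where p: "p \<in> D" "\<And>n. f p \<le> m + 1 / Suc n" by blast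
  have "f p \<le> m"
  proof (rule LIMSEQ_le_const)
    show "(\<lambda>n. m + 1 / Suc n) \<longlonglongrightarrow> m"
      using tendsto_add[OF tendsto_const LIMSEQ_Suc[OF lim_1_over_n]] by force
  qed (use p in auto)
  then show ?thesis
    using p bdd by (force simp: m_def intro: cInf_lower order_trans)
qed

section \<open>Proximal points and the Riesz representation\<close>

lemma ge_if_ge_minus_small:
  fixes a b c :: real
  assumes "\<And>t. 0 < t \<Longrightarrow> t < 1 \<Longrightarrow> b - t * c \<le> a"
  shows "b \<le> a"
proof -
  have "((\<lambda>t. b - t * c) \<longlongrightarrow> b - 0 * c) (at_right 0)"
    by (intro tendsto_intros)
  moreover have "eventually (\<lambda>t. b - t * c \<le> a) (at_right 0)"
    using assms by (auto simp: eventually_at_right[of 0 1] intro!: exI[of _ 1])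
  ultimately show ?thesis
    using tendsto_upperbound by fastforce
qed

text \<open>The point \<open>p\<close> is the proximal point, the minimiser of
  \<open>\<phi> y - u \<bullet> y + \<epsilon>/2 \<parallel>y\<parallel>\<^sup>2\<close> over \<open>D\<close>.\<close>

lemma exists_proximal_point:
  fixes \<phi> :: "'a::{real_inner, banach} \<Rightarrow> real"
  assumes ne: "D \<noteq> {}" and conv: "convex_on D \<phi>"
    and closed: "\<And>r. continuous_on UNIV r \<Longrightarrow> closed {x\<in>D. \<phi> x \<le> r x}"
    and minorant: "\<And>x. x \<in> D \<Longrightarrow> a - b * norm x \<le> \<phi> x"
    and \<epsilon>: "\<epsilon> > 0"
  shows "\<exists>p\<in>D. \<forall>y\<in>D. \<phi> p + (u - \<epsilon> *\<^sub>R p) \<bullet> (y - p) \<le> \<phi> y"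
proof -
  have D: "convex D" using conv by (rule convex_on_imp_convex)
  define q where "q x = \<epsilon> / 2 * (norm x)\<^sup>2 - u \<bullet> x" for x
  have q_conv: "convex_on D q"
    unfolding q_def
  proof (rule convex_on_diff)
    have "convex_on D (\<lambda>x. norm x ^ 2)"
    proof (rule convex_onI[OF _ D])
      fix t :: real and x y :: 'a assume t: "0 < t" "t < 1"
      have "(1 - t) * (norm x)\<^sup>2 + t * (norm y)\<^sup>2 - (norm ((1 - t) *\<^sub>R x + t *\<^sub>R y))\<^sup>2
          = t * (1 - t) * (norm (x - y))\<^sup>2"
        unfolding power2_norm_eq_inner by (simp add: inner_simps inner_commute algebra_simps)
      also have "\<dots> \<ge> 0" using t by simp
      finally show "(norm ((1 - t) *\<^sub>R x + t *\<^sub>R y))\<^sup>2 \<le> (1 - t) * (norm x)\<^sup>2 + t * (norm y)\<^sup>2"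
        by simp
    qed
    then show "convex_on D (\<lambda>x. \<epsilon> / 2 * (norm x)\<^sup>2)"
      using \<epsilon> by (intro convex_on_cmul) auto
    show "concave_on D (\<lambda>x. u \<bullet> x)"
      unfolding concave_on_def using D
      by (intro convex_onI) (auto simp: inner_simps algebra_simps)
  qed
  \<comment> \<open>The quadratic term dominates the minorant of linear growth. The case
    \<open>norm x \<le> 1\<close> is split off so that the constant \<open>c - a\<close> can be
    absorbed into a multiple of \<open>norm x\<close>.\<close>
  have bnd: "bounded {x\<in>D. \<phi> x + q x \<le> c}" for c
  proof -
    define K where "K = \<bar>b\<bar> + norm u"
    have "norm x \<le> 1 + 2 / \<epsilon> * (K + \<bar>c - a\<bar>)" if x: "x \<in> D" "\<phi> x + q x \<le> c" for x
    proof (cases "norm x \<le> 1")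
      case True
      moreover have "0 \<le> 2 / \<epsilon> * (K + \<bar>c - a\<bar>)" using \<epsilon> by (simp add: K_def)
      ultimately show ?thesis by simp
    next
      case False
      have "b * norm x + u \<bullet> x \<le> K * norm x"
        unfolding K_def distrib_right
        by (intro add_mono norm_cauchy_schwarz mult_right_mono) auto
      then have "\<epsilon> / 2 * (norm x)\<^sup>2 \<le> K * norm x + (c - a)"
        using minorant[OF x(1)] x(2) by (simp add: q_def inner_simps)
      also have "c - a \<le> \<bar>c - a\<bar> * norm x"
        using False by (smt (verit) mult_left_le mult_le_cancel_left1 mult_cancel_left1)
      finally have "norm x * (\<epsilon> / 2 * norm x) \<le> norm x * (K + \<bar>c - a\<bar>)"
        by (simp add: power2_eq_square algebra_simps)
      moreover have "norm x > 0" using False by linarith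
      ultimately have "\<epsilon> / 2 * norm x \<le> K + \<bar>c - a\<bar>"
        by (metis mult_le_cancel_left_pos)
      then show ?thesis using \<epsilon> by (simp add: field_simps)
    qed
    then show ?thesis by (auto simp: bounded_iff)
  qed
  have "\<exists>p\<in>D. \<forall>y\<in>D. \<phi> p + q p \<le> \<phi> y + q y"
  proof (rule attains_min_if_sublevels_bounded[OF ne _ _ bnd])
    fix c
    \<comment> \<open>Moving \<open>q\<close> to the right is why closedness is assumed for bounds
      \<open>r\<close> that vary with \<open>x\<close>.\<close>
    have "{x\<in>D. \<phi> x + q x \<le> c} = {x\<in>D. \<phi> x \<le> c - q x}" by auto
    also have "closed \<dots>"
      unfolding q_def by (intro closed continuous_intros)
    finally show "closed {x\<in>D. \<phi> x + q x \<le> c}" .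
    show "convex {x\<in>D. \<phi> x + q x \<le> c}"
      using convex_on_add[OF conv q_conv] by (rule convex_sublevel)
  qed
  then obtain p where p: "p \<in> D" and min: "\<And>y. y \<in> D \<Longrightarrow> \<phi> p + q p \<le> \<phi> y + q y"
    by blast
  have "\<phi> p + (u - \<epsilon> *\<^sub>R p) \<bullet> (y - p) \<le> \<phi> y" if y: "y \<in> D" for y
  proof (rule ge_if_ge_minus_small)
    fix t :: real assume t: "0 < t" "t < 1"
    \<comment> \<open>Moving from \<open>p\<close> towards \<open>y\<close> changes \<open>q\<close>
      to first order in \<open>t\<close> by the inner product and only to order \<open>t^2\<close>
      otherwise. Division by \<open>t\<close> leaves an error that vanishes with
      \<open>t\<close>.\<close>
    let ?x = "(1 - t) *\<^sub>R p + t *\<^sub>R y"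
    have "?x \<in> D" using D p y t by (intro convexD) auto
    then have "\<phi> p + q p \<le> \<phi> ?x + q ?x" by (rule min)
    also have "\<phi> ?x \<le> (1 - t) * \<phi> p + t * \<phi> y"
      using convex_onD[OF conv] t p y by simp
    also have "q ?x = q p - t * ((u - \<epsilon> *\<^sub>R p) \<bullet> (y - p)) + t * (t * (\<epsilon> / 2 * (norm (y - p))\<^sup>2))"
      unfolding q_def power2_norm_eq_inner
      by (simp add: inner_simps inner_commute algebra_simps add_divide_distrib diff_divide_distrib)
    finally have "t * (\<phi> p + (u - \<epsilon> *\<^sub>R p) \<bullet> (y - p) - t * (\<epsilon> / 2 * (norm (y - p))\<^sup>2)) \<le> t * \<phi> y"
      by (simp add: algebra_simps)
    then show "\<phi> p + (u - \<epsilon> *\<^sub>R p) \<bullet> (y - p) - t * (\<epsilon> / 2 * (norm (y - p))\<^sup>2) \<le> \<phi> y"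
      using t by (simp add: mult_le_cancel_left_pos)
  qed
  then show ?thesis using p by blast
qed

text \<open>The representer minimises \<open>(norm y)^2 / 2 - f y\<close>, so it is a proximal point
  of \<open>- f\<close>. By linearity the subgradient inequality there gives
  \<open>f h \<le> p \<bullet> h\<close> for both \<open>h\<close> and \<open>- h\<close>, hence
  equality.\<close>

lemma Riesz_representation:
  fixes f :: "'a::{real_inner, banach} \<Rightarrow> real"
  assumes f: "bounded_linear f"
  shows "\<exists>D. \<forall>h. f h = D \<bullet> h"
proof -
  interpret bounded_linear f by (rule f)
  obtain K where K: "\<And>x. norm (f x) \<le> norm x * K" using bounded by blast
  have conv: "convex_on UNIV (\<lambda>x. - f x)"
    by (intro convex_onI) (auto simp: add scaleR)
  have "\<exists>p\<in>UNIV. \<forall>y\<in>UNIV. - f p + (0 - 1 *\<^sub>R p) \<bullet> (y - p) \<le> - f y"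
  proof (rule exists_proximal_point[OF _ conv])
    show "closed {x\<in>UNIV. - f x \<le> r x}" if "continuous_on UNIV r" for r
      using that linear_continuous_on[OF f] closed_Collect_le[of "\<lambda>x. - f x" r]
      by (auto intro: continuous_intros)
    show "0 - K * norm x \<le> - f x" for x
      using K[of x] by (simp add: mult.commute)
  qed auto
  then obtain p where p: "\<And>y. - f p - p \<bullet> (y - p) \<le> - f y"
    by auto
  have le: "f h \<le> p \<bullet> h" for h
    using p[of "p + h"] by (simp add: add)
  have "f h = p \<bullet> h" for h
    using le[of h] le[of "- h"] neg[of h] by simp
  then show ?thesis by blast
qed

section \<open>Frechet and Gateaux gradients\<close>

lemma GDERIV_unique:
  assumes "GDERIV f x :> D" "GDERIV f x :> E"
  shows "D = E"
proof -
  have "(\<lambda>h. h \<bullet> D) = (\<lambda>h. h \<bullet> E)"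
    using assms unfolding gderiv_def by (rule has_derivative_unique)
  then have "(D - E) \<bullet> D = (D - E) \<bullet> E" by metis
  then have "(D - E) \<bullet> (D - E) = 0" by (simp add: inner_diff_right)
  then show ?thesis by simp
qed

lemma GDERIV_imp_grad_eq:
  assumes "x \<in> interior (dom_fun f)" "GDERIV (\<lambda>y. real_of_ereal (f y)) x :> D"
  shows "grad f x = D"
  unfolding grad_def using assms by (auto intro: the_equality GDERIV_unique)

text \<open>The Riesz representation supplies the vector that \<open>THE\<close> in
  \<open>grad\<close> selects.\<close>

lemma GDERIV_grad:
  fixes f :: "'a::{real_inner, banach} \<Rightarrow> ereal"
  assumes "x \<in> interior (dom_fun f)" "(\<lambda>y. real_of_ereal (f y)) differentiable (at x)"
  shows "GDERIV (\<lambda>y. real_of_ereal (f y)) x :> grad f x"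
proof -
  obtain f' where f': "((\<lambda>y. real_of_ereal (f y)) has_derivative f') (at x)"
    using assms(2) by (auto simp: differentiable_def)
  obtain D where "\<And>h. f' h = D \<bullet> h"
    using Riesz_representation[OF has_derivative_bounded_linear[OF f']] by blast
  then have "f' = (\<lambda>h. h \<bullet> D)" by (auto simp: inner_commute)
  then have "GDERIV (\<lambda>y. real_of_ereal (f y)) x :> D"
    using f' by (simp add: gderiv_def)
  then show ?thesis using GDERIV_imp_grad_eq[OF assms(1)] by metis
qed

lemma GDERIV_imp_directional_derivative:
  assumes "GDERIV f x :> D"
  shows "((\<lambda>t. f (x + t *\<^sub>R h)) has_real_derivative (D \<bullet> h)) (at 0)"
proof -
  have "((\<lambda>t::real. x + t *\<^sub>R h) has_derivative (\<lambda>t. t *\<^sub>R h)) (at 0)"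
    by (auto intro!: derivative_eq_intros)
  moreover have "(f has_derivative (\<lambda>h. h \<bullet> D)) (at (x + 0 *\<^sub>R h))"
    using assms by (simp add: gderiv_def)
  ultimately have "((\<lambda>t. f (x + t *\<^sub>R h)) has_derivative (\<lambda>t. (t *\<^sub>R h) \<bullet> D)) (at 0)"
    by (rule has_derivative_compose)
  then show ?thesis
    by (simp add: has_field_derivative_def inner_commute mult.commute[of _ "D \<bullet> h"])
qed

text \<open>Directional derivatives determine the representer. This serves the conjugate, for which
  a Gateaux gradient is constructed.\<close>

lemma grad_eq_gateaux_gradient:
  fixes f :: "'a::{real_inner, banach} \<Rightarrow> ereal"
  assumes gat: "has_gateaux_gradient f x D"
    and diff: "(\<lambda>y. real_of_ereal (f y)) differentiable (at x)"
  shows "grad f x = D"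
proof -
  have "{y. \<bar>f y\<bar> \<noteq> \<infinity>} \<subseteq> dom_fun f" by (auto simp: dom_fun_def)
  then have "x \<in> interior (dom_fun f)"
    using gat interior_mono unfolding has_gateaux_gradient_def by blast
  then have G: "GDERIV (\<lambda>y. real_of_ereal (f y)) x :> grad f x"
    using diff by (rule GDERIV_grad)
  have "grad f x \<bullet> h = D \<bullet> h" for h
    using GDERIV_imp_directional_derivative[OF G, of h] gat DERIV_unique
    unfolding has_gateaux_gradient_def by blast
  then have "(grad f x - D) \<bullet> (grad f x - D) = 0"
    by (simp add: inner_diff_left)
  then show ?thesis by simp
qed

section \<open>Lower semicontinuity\<close>

lemma closed_sublevel_lower_semicontinuous:
  assumes lsc: "lower_semicontinuous \<Phi>" and r: "continuous_on UNIV (r :: _ \<Rightarrow> real)"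
  shows "closed {x. \<Phi> x \<le> ereal (r x)}"
  unfolding closed_def
proof (subst open_subopen, intro ballI)
  fix x assume "x \<in> - {x. \<Phi> x \<le> ereal (r x)}"
  then have "ereal (r x) < \<Phi> x" by simp
  from ereal_dense2[OF this] obtain a where a: "r x < a" "ereal a < \<Phi> x"
    by auto
  \<comment> \<open>\<open>Liminf (at x)\<close> ignores the value at \<open>x\<close>;
    \<open>a(2)\<close> supplies it, which turns \<open>at x\<close> into
    \<open>nhds x\<close>.\<close>
  have "eventually (\<lambda>y. ereal a < \<Phi> y) (at x)"
    using lsc a(2) by (simp add: lower_semicontinuous_def le_Liminf_iff)
  then have ev1: "eventually (\<lambda>y. ereal a < \<Phi> y) (nhds x)"
    using a(2) by (auto simp: eventually_nhds_conv_at)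
  have "(r \<longlongrightarrow> r x) (nhds x)"
    using r by (simp add: continuous_on_def tendsto_at_iff_tendsto_nhds)
  then have "eventually (\<lambda>y. r y < a) (nhds x)"
    using a(1) by (rule order_tendstoD)
  with ev1 have "eventually (\<lambda>y. ereal (r y) < \<Phi> y) (nhds x)"
    by eventually_elim (rule less_trans[of _ "ereal a"], auto)
  then obtain T where "open T" "x \<in> T" "\<forall>y\<in>T. ereal (r y) < \<Phi> y"
    unfolding eventually_nhds by blast
  then show "\<exists>T. open T \<and> x \<in> T \<and> T \<subseteq> - {x. \<Phi> x \<le> ereal (r x)}"
    by (intro exI[of _ T]) (simp add: subset_iff not_le)
qed

lemma borel_measurable_lower_semicontinuous:
  assumes "lower_semicontinuous \<Phi>"
  shows "\<Phi> \<in> borel_measurable borel"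
  unfolding borel_measurable_iff_Iic_ereal
proof
  fix a
  have "{x. \<Phi> x \<le> ereal b} \<in> sets borel" for b
    using closed_sublevel_lower_semicontinuous[OF assms, of "\<lambda>_. b"] by auto
  \<comment> \<open>Closedness is known at real levels; the level \<open>-\<infinity>\<close> is a
    countable intersection of these.\<close>
  moreover have "{x. \<Phi> x \<le> -\<infinity>} = (\<Inter>n::nat. {x. \<Phi> x \<le> ereal (- real n)})"
  proof -
    have "\<Phi> x = -\<infinity>" if "\<And>n::nat. \<Phi> x \<le> ereal (- real n)" for x
    proof (cases "\<Phi> x")
      case (real c)
      obtain n :: nat where "- c < n" using reals_Archimedean2 by blast
      with that[of n] real show ?thesis by simp
    qed (use that[of 0] in auto)
    then show ?thesis by auto
  qed
  ultimately show "\<Phi> -` {..a} \<inter> space borel \<in> sets borel"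
    by (cases a) (auto simp: vimage_def simp del: ereal_infty_less_eq2)
qed

section \<open>Convexity and the gradient inequality\<close>

locale generator_function =
  fixes \<Phi> :: "'a::{real_inner, banach} \<Rightarrow> ereal"
  assumes generator: "generator \<Phi>"
begin

abbreviation \<phi> :: "'a \<Rightarrow> real" where "\<phi> x \<equiv> real_of_ereal (\<Phi> x)"
abbreviation D :: "'a set" where "D \<equiv> dom_fun \<Phi>"

text \<open>\<open>real_of_ereal\<close> sends \<open>\<infinity>\<close> to \<open>0\<close>, so
  \<open>\<phi>\<close> carries no information off \<open>D\<close>. Passing between
  \<open>\<Phi>\<close> and \<open>\<phi>\<close> therefore goes through this case split.\<close>

lemma value_cases:
  obtains (dom) c where "x \<in> D" "\<Phi> x = ereal c" | (off_dom) "x \<notin> D" "\<Phi> x = \<infinity>"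
  using generator by (cases "\<Phi> x") (auto simp: generator_def proper_fun_def dom_fun_def)

text \<open>The right-hand side of strict convexity is finite on \<open>D\<close>, so the inequality
  itself puts the intermediate point in \<open>D\<close>.\<close>

lemma
  assumes "x \<in> D" "y \<in> D" "x \<noteq> y" "0 < t" "t < 1"
  shows segment_in_dom: "(1 - t) *\<^sub>R x + t *\<^sub>R y \<in> D"
    and strictly_convex_on_dom: "\<phi> ((1 - t) *\<^sub>R x + t *\<^sub>R y) < (1 - t) * \<phi> x + t * \<phi> y"
proof -
  have "\<Phi> ((1 - t) *\<^sub>R x + t *\<^sub>R y) < ereal (1 - t) * \<Phi> x + ereal t * \<Phi> y"
    using generator assms unfolding generator_def strictly_convex_on_def by blast
  then have less: "\<Phi> ((1 - t) *\<^sub>R x + t *\<^sub>R y) < ereal ((1 - t) * \<phi> x + t * \<phi> y)"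
    using assms(1,2) by (cases x rule: value_cases; cases y rule: value_cases) auto
  then show dom: "(1 - t) *\<^sub>R x + t *\<^sub>R y \<in> D"
    by (auto simp: dom_fun_def)
  show "\<phi> ((1 - t) *\<^sub>R x + t *\<^sub>R y) < (1 - t) * \<phi> x + t * \<phi> y"
    using less dom by (cases "(1 - t) *\<^sub>R x + t *\<^sub>R y" rule: value_cases) auto
qed

lemma convex_dom: "convex D"
  unfolding convex_alt
proof (intro ballI allI impI)
  fix x y and u :: real assume "x \<in> D" "y \<in> D" "0 \<le> u \<and> u \<le> 1"
  then show "(1 - u) *\<^sub>R x + u *\<^sub>R y \<in> D"
    using segment_in_dom[of x y u]
    by (cases "x = y \<or> u = 0 \<or> u = 1") (auto simp: scaleR_left_distrib[symmetric])
qed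

lemma convex_on_dom: "convex_on D \<phi>"
proof (rule convex_onI[OF _ convex_dom])
  fix t :: real and x y assume "0 < t" "t < 1" "x \<in> D" "y \<in> D"
  then show "\<phi> ((1 - t) *\<^sub>R x + t *\<^sub>R y) \<le> (1 - t) * \<phi> x + t * \<phi> y"
    using strictly_convex_on_dom[of x y t]
    by (cases "x = y") (auto simp: scaleR_left_distrib[symmetric] algebra_simps)
qed

lemma convex_on_tilted: "convex_on D (\<lambda>f. \<phi> f - u \<bullet> f)"
proof -
  have "convex_on D (\<lambda>f. - (u \<bullet> f))"
    using convex_dom by (intro convex_onI) (auto simp: inner_simps algebra_simps)
  then show ?thesis
    using convex_on_add[OF convex_on_dom] by fastforce
qed

lemma closed_sublevel:
  assumes "continuous_on UNIV r"
  shows "closed {x\<in>D. \<phi> x \<le> r x}"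
proof -
  have "{x\<in>D. \<phi> x \<le> r x} = {x. \<Phi> x \<le> ereal (r x)}"
  proof (intro set_eqI)
    fix x show "x \<in> {x\<in>D. \<phi> x \<le> r x} \<longleftrightarrow> x \<in> {x. \<Phi> x \<le> ereal (r x)}"
      by (cases x rule: value_cases) auto
  qed
  then show ?thesis
    using closed_sublevel_lower_semicontinuous[OF _ assms] generator
    by (simp add: generator_def)
qed

text \<open>Convexity bounds the difference quotients along the segment by
  \<open>\<phi> y - \<phi> x\<close>, and they tend to the directional derivative at
  \<open>x\<close>. The point \<open>y\<close> may lie on the boundary of \<open>D\<close>.\<close>

lemma gradient_inequality:
  assumes x: "x \<in> interior D" and y: "y \<in> D"
  shows "\<phi> x + grad \<Phi> x \<bullet> (y - x) \<le> \<phi> y"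
proof -
  have xD: "x \<in> D" using x interior_subset by blast
  have "GDERIV \<phi> x :> grad \<Phi> x"
    using x generator by (intro GDERIV_grad) (auto simp: generator_def)
  from GDERIV_imp_directional_derivative[OF this, of "y - x"]
  have "((\<lambda>t. (\<phi> (x + t *\<^sub>R (y - x)) - \<phi> x) / t) \<longlongrightarrow> grad \<Phi> x \<bullet> (y - x)) (at 0)"
    by (simp add: has_field_derivative_iff)
  then have "((\<lambda>t. (\<phi> (x + t *\<^sub>R (y - x)) - \<phi> x) / t) \<longlongrightarrow> grad \<Phi> x \<bullet> (y - x)) (at_right 0)"
    by (rule tendsto_mono[OF at_le[OF subset_UNIV]])
  moreover have "eventually (\<lambda>t. (\<phi> (x + t *\<^sub>R (y - x)) - \<phi> x) / t \<le> \<phi> y - \<phi> x) (at_right 0)"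
    unfolding eventually_at_right[OF zero_less_one]
  proof (intro exI[of _ 1] conjI allI impI)
    fix t :: real assume t: "0 < t" "t < 1"
    have "x + t *\<^sub>R (y - x) = (1 - t) *\<^sub>R x + t *\<^sub>R y" by (simp add: algebra_simps)
    then have "\<phi> (x + t *\<^sub>R (y - x)) \<le> (1 - t) * \<phi> x + t * \<phi> y"
      using convex_onD[OF convex_on_dom, of t x y] t xD y by simp
    then show "(\<phi> (x + t *\<^sub>R (y - x)) - \<phi> x) / t \<le> \<phi> y - \<phi> x"
      using t by (simp add: field_simps)
  qed simp
  ultimately have "grad \<Phi> x \<bullet> (y - x) \<le> \<phi> y - \<phi> x"
    by (rule tendsto_upperbound) simp
  then show ?thesis by simp
qed

text \<open>The plain inequality is applied at the midpoint, where strict convexity leaves a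
  gap.\<close>

lemma strict_gradient_inequality:
  assumes x: "x \<in> interior D" and y: "y \<in> D" and "x \<noteq> y"
  shows "\<phi> x + grad \<Phi> x \<bullet> (y - x) < \<phi> y"
proof -
  let ?m = "(1 - 1/2) *\<^sub>R x + (1/2) *\<^sub>R y"
  have xD: "x \<in> D" using x interior_subset by blast
  have "?m \<in> D" "\<phi> ?m < (1 - 1/2) * \<phi> x + 1/2 * \<phi> y"
    using segment_in_dom[of x y "1/2"] strictly_convex_on_dom[of x y "1/2"] assms xD by auto
  moreover have "grad \<Phi> x \<bullet> (?m - x) = 1/2 * (grad \<Phi> x \<bullet> (y - x))"
    by (simp add: inner_simps)
  ultimately show ?thesis
    using gradient_inequality[OF x, of ?m] by simp
qed

lemma bregman_nonneg: "x \<in> interior D \<Longrightarrow> y \<in> D \<Longrightarrow> 0 \<le> bregman \<Phi> y x"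
  using gradient_inequality[of x y] by (simp add: bregman_def)

lemma bregman_pos: "x \<in> interior D \<Longrightarrow> y \<in> D \<Longrightarrow> x \<noteq> y \<Longrightarrow> 0 < bregman \<Phi> y x"
  using strict_gradient_inequality[of x y] by (simp add: bregman_def)

text \<open>With equal gradients, the two strict inequalities obtained by exchanging
  \<open>x\<close> and \<open>y\<close> add up to \<open>0 < 0\<close>.\<close>

lemma inj_on_grad: "inj_on (grad \<Phi>) (interior D)"
proof (rule inj_onI, rule ccontr)
  fix x y assume xy: "x \<in> interior D" "y \<in> interior D" "grad \<Phi> x = grad \<Phi> y" "x \<noteq> y"
  then have "x \<in> D" "y \<in> D" using interior_subset by blast+
  then show False
    using strict_gradient_inequality[of x y] strict_gradient_inequality[of y x] xy
    by (simp add: inner_simps)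
qed

section \<open>Subdifferential and conjugate\<close>

lemma subdifferential_iff:
  "u \<in> subdifferential \<Phi> x \<longleftrightarrow> x \<in> D \<and> (\<forall>y\<in>D. \<phi> x + u \<bullet> (y - x) \<le> \<phi> y)"
proof -
  have "(\<Phi> x + ereal (u \<bullet> (y - x)) \<le> \<Phi> y) \<longleftrightarrow> (y \<in> D \<longrightarrow> \<phi> x + u \<bullet> (y - x) \<le> \<phi> y)"
    if "x \<in> D" for y
    using that by (cases x rule: value_cases; cases y rule: value_cases) auto
  then show ?thesis by (auto simp: subdifferential_def)
qed

lemma grad_in_subdifferential:
  "x \<in> interior D \<Longrightarrow> grad \<Phi> x \<in> subdifferential \<Phi> x"
  using gradient_inequality interior_subset by (auto simp: subdifferential_iff)

text \<open>This makes \<open>x\<close> the only minimiser of \<open>\<Phi>\<close> tilted by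
  \<open>grad \<Phi> x\<close>. It goes beyond \<open>inj_on_grad\<close>, since \<open>y\<close>
  may be a boundary point of \<open>D\<close>.\<close>

lemma grad_in_subdifferential_imp_eq:
  assumes "x \<in> interior D" "grad \<Phi> x \<in> subdifferential \<Phi> y"
  shows "y = x"
proof (rule ccontr)
  assume "y \<noteq> x"
  then have "\<phi> x + grad \<Phi> x \<bullet> (y - x) < \<phi> y"
    using assms by (intro strict_gradient_inequality) (auto simp: subdifferential_iff)
  moreover have "\<phi> y + grad \<Phi> x \<bullet> (x - y) \<le> \<phi> x"
    using assms interior_subset by (auto simp: subdifferential_iff)
  ultimately show False by (simp add: inner_simps)
qed

lemma conjugate_ge: "f \<in> D \<Longrightarrow> ereal (u \<bullet> f - \<phi> f) \<le> convex_conjugate \<Phi> u"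
  unfolding convex_conjugate_def
  by (intro SUP_upper2[of f]) (cases f rule: value_cases; auto)+

lemma conjugate_le:
  assumes "\<And>f. f \<in> D \<Longrightarrow> u \<bullet> f - \<phi> f \<le> C"
  shows "convex_conjugate \<Phi> u \<le> ereal C"
  unfolding convex_conjugate_def
proof (rule SUP_least)
  fix f show "ereal (u \<bullet> f) - \<Phi> f \<le> ereal C"
    using assms[of f] by (cases f rule: value_cases) auto
qed

text \<open>Equality case of the Fenchel-Young inequality: the supremum is attained at
  \<open>p\<close>.\<close>

lemma conjugate_eq:
  assumes "u \<in> subdifferential \<Phi> p"
  shows "convex_conjugate \<Phi> u = ereal (u \<bullet> p - \<phi> p)"
proof (rule antisym[OF conjugate_le conjugate_ge])
  show "p \<in> D" using assms by (simp add: subdifferential_iff)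
  show "u \<bullet> f - \<phi> f \<le> u \<bullet> p - \<phi> p" if "f \<in> D" for f
    using assms that by (force simp: subdifferential_iff inner_simps)
qed

section \<open>Gateaux differentiability of the conjugate\<close>

text \<open>In infinite dimension a point at which \<open>(\<partial>\<Phi>)\<^sup>-\<^sup>1\<close> is locally bounded must be shown to be
  interior to its domain. For \<open>u\<close> near \<open>z\<close>, the proximal points \<open>p\<close> of
  \<open>\<Phi> - u\<close> centred at \<open>g\<close> satisfy \<open>u - \<epsilon> (p - g) \<in> \<partial>\<Phi> p\<close>; by monotonicity this
  subgradient is close to \<open>z\<close>, so \<open>p\<close> stays bounded while \<open>\<epsilon> \<rightarrow> 0\<close>.\<close>

lemma affine_bound_near_subgradient:
  assumes z: "z \<in> subdifferential \<Phi> g"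
    and K: "\<And>u f. norm (u - z) < r \<Longrightarrow> u \<in> subdifferential \<Phi> f \<Longrightarrow> norm f \<le> K"
    and u: "norm (u - z) < r / 2" and f: "f \<in> D"
  shows "u \<bullet> f - \<phi> f \<le> r * K + z \<bullet> g - \<phi> g"
proof -
  have g: "g \<in> D" and zg: "\<And>y. y \<in> D \<Longrightarrow> \<phi> g + z \<bullet> (y - g) \<le> \<phi> y"
    using z by (auto simp: subdifferential_iff)
  have r: "r > 0" using u norm_ge_zero[of "u - z"] by linarith
  have "u \<bullet> f - \<phi> f - \<epsilon> * ((K + norm g) * norm f) \<le> r * K + z \<bullet> g - \<phi> g"
    if \<epsilon>: "0 < \<epsilon>" for \<epsilon>
  proof -
    have minorant: "(\<phi> g - z \<bullet> g) - norm z * norm x \<le> \<phi> x" if "x \<in> D" for x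
      using zg[OF that] Cauchy_Schwarz_ineq2[of z x] by (simp add: inner_simps)
    \<comment> \<open>Adding \<open>\<epsilon> *\<^sub>R g\<close> to \<open>u\<close> moves the
      centre of the quadratic term from \<open>0\<close> to \<open>g\<close>.\<close>
    obtain p where p: "p \<in> D"
      and sub: "\<And>y. y \<in> D \<Longrightarrow> \<phi> p + ((u + \<epsilon> *\<^sub>R g) - \<epsilon> *\<^sub>R p) \<bullet> (y - p) \<le> \<phi> y"
      using exists_proximal_point[OF _ convex_on_dom closed_sublevel minorant \<epsilon>, of "u + \<epsilon> *\<^sub>R g"] g
      by blast
    define w where "w = u - \<epsilon> *\<^sub>R (p - g)"
    have w: "w \<in> subdifferential \<Phi> p"
      using p sub by (simp add: subdifferential_iff w_def algebra_simps)
    \<comment> \<open>Their sum is the monotonicity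
      \<open>0 \<le> (w - z) \<bullet> (p - g)\<close>, in which \<open>w\<close> is then
      expanded.\<close>
    have "\<phi> p + w \<bullet> (g - p) \<le> \<phi> g" "\<phi> g + z \<bullet> (p - g) \<le> \<phi> p"
      using w g p zg by (auto simp: subdifferential_iff)
    then have "\<epsilon> * (norm (p - g) * norm (p - g)) \<le> (u - z) \<bullet> (p - g)"
      unfolding power2_eq_square[symmetric] power2_norm_eq_inner
      by (simp add: w_def inner_simps inner_commute algebra_simps)
    also have "\<dots> \<le> norm (u - z) * norm (p - g)" by (rule norm_cauchy_schwarz)
    finally have "norm (p - g) * (\<epsilon> * norm (p - g)) \<le> norm (p - g) * norm (u - z)"
      by (simp add: mult_ac)
    then have close: "\<epsilon> * norm (p - g) \<le> norm (u - z)"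
      by (cases "p = g") auto
    \<comment> \<open>Both summands are below \<open>r / 2\<close>, which is why \<open>u\<close> is
      restricted to half the radius.\<close>
    have "norm (w - z) \<le> norm (u - z) + \<epsilon> * norm (p - g)"
      using norm_triangle_ineq4[of "u - z" "\<epsilon> *\<^sub>R (p - g)"] \<epsilon>
      by (simp add: w_def diff_diff_eq add.commute)
    then have wz: "norm (w - z) < r" using close u by simp
    have pK: "norm p \<le> K" using K[OF wz w] .
    have "(w - z) \<bullet> p \<le> r * K"
      using norm_cauchy_schwarz[of "w - z" p] wz pK r
      by (smt (verit) mult_mono norm_ge_zero)
    \<comment> \<open>The bound \<open>K\<close> on \<open>p\<close> does not depend on
      \<open>\<epsilon>\<close>, so this error is linear in \<open>\<epsilon>\<close> and disappears
      in the limit.\<close>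
    moreover have "(u - w) \<bullet> f \<le> \<epsilon> * ((K + norm g) * norm f)"
    proof -
      have "(u - w) \<bullet> f \<le> norm (u - w) * norm f" by (rule norm_cauchy_schwarz)
      also have "norm (u - w) = \<epsilon> * norm (p - g)" using \<epsilon> by (simp add: w_def)
      also have "norm (p - g) \<le> K + norm g"
        using norm_triangle_ineq4[of p g] pK by simp
      finally show ?thesis using \<epsilon> by (simp add: mult_ac mult_left_mono mult_right_mono)
    qed
    moreover have "\<phi> p + w \<bullet> (f - p) \<le> \<phi> f"
      using w f by (auto simp: subdifferential_iff)
    \<comment> \<open>With \<open>u = (u - w) + w\<close>, the subgradient inequality for
      \<open>w\<close> replaces \<open>f\<close> by \<open>p\<close>; with
      \<open>w = (w - z) + z\<close>, the one for \<open>z\<close> replaces \<open>p\<close> by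
      \<open>g\<close>.\<close>
    ultimately show ?thesis using zg[OF p] by (simp add: inner_simps)
  qed
  then show ?thesis by (rule ge_if_ge_minus_small)
qed

text \<open>The upper bound on a ball makes \<open>\<Phi> - u\<close> coercive: tested at
  \<open>u + (r / 2) *\<^sub>R sgn f\<close>, it bounds \<open>r / 2 * norm f\<close> on each
  sublevel set. A minimiser of \<open>\<Phi> - u\<close> has \<open>u\<close> as a
  subgradient.\<close>

lemma subgradient_range_near:
  assumes r: "0 < r" and ne: "D \<noteq> {}"
    and bound: "\<And>u f. norm (u - z) < r \<Longrightarrow> f \<in> D \<Longrightarrow> u \<bullet> f - \<phi> f \<le> C"
    and u: "norm (u - z) < r / 2"
  shows "\<exists>p. u \<in> subdifferential \<Phi> p"
proof -
  have "\<exists>p\<in>D. \<forall>y\<in>D. \<phi> p - u \<bullet> p \<le> \<phi> y - u \<bullet> y"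
  proof (rule attains_min_if_sublevels_bounded[OF ne _ convex_sublevel[OF convex_on_tilted]])
    fix c
    have "{f\<in>D. \<phi> f - u \<bullet> f \<le> c} = {f\<in>D. \<phi> f \<le> c + u \<bullet> f}" by auto
    also have "closed \<dots>" by (intro closed_sublevel continuous_intros)
    finally show "closed {f\<in>D. \<phi> f - u \<bullet> f \<le> c}" .
    have "norm f \<le> 2 / r * (C + c)" if f: "f \<in> D" "\<phi> f - u \<bullet> f \<le> c" for f
    proof -
      have "norm ((r / 2) *\<^sub>R sgn f) \<le> r / 2"
        using r by (simp add: norm_sgn)
      then have "norm (u + (r / 2) *\<^sub>R sgn f - z) < r"
        using norm_triangle_ineq[of "u - z" "(r / 2) *\<^sub>R sgn f"] u
        by (simp add: algebra_simps del: norm_scaleR)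
      from bound[OF this f(1)] f(2) have "r / 2 * (sgn f \<bullet> f) \<le> C + c"
        by (simp add: inner_simps)
      moreover have "sgn f \<bullet> f = norm f"
        by (cases "f = 0") (simp_all add: sgn_div_norm power2_norm_eq_inner[symmetric] power2_eq_square)
      ultimately show ?thesis using r by (simp add: field_simps)
    qed
    then show "bounded {f\<in>D. \<phi> f - u \<bullet> f \<le> c}" by (auto simp: bounded_iff)
  qed
  then show ?thesis by (force simp: subdifferential_iff inner_simps)
qed

text \<open>For \<open>u\<close> near \<open>z\<close>, a point \<open>p\<close> with subgradient
  \<open>u\<close> almost minimises \<open>\<Phi> - z\<close>. If such points stayed on the far side
  of a hyperplane off \<open>g\<close>, a second exact minimiser would arise, against
  \<open>uniq\<close>.\<close>

lemma subgradient_inverse_weakly_continuous: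
  assumes z: "z \<in> subdifferential \<Phi> g"
    and uniq: "\<And>f. z \<in> subdifferential \<Phi> f \<Longrightarrow> f = g"
    and r: "0 < r" and K: "\<And>u f. norm (u - z) < r \<Longrightarrow> u \<in> subdifferential \<Phi> f \<Longrightarrow> norm f \<le> K"
    and \<delta>: "0 < \<delta>"
  obtains \<eta> where "\<eta> > 0"
    "\<And>u p. norm (u - z) < \<eta> \<Longrightarrow> u \<in> subdifferential \<Phi> p \<Longrightarrow> h \<bullet> (p - g) < \<delta>"
proof -
  have g: "g \<in> D" and zg: "\<And>y. y \<in> D \<Longrightarrow> \<phi> g + z \<bullet> (y - g) \<le> \<phi> y"
    using z by (auto simp: subdifferential_iff)
  have "0 \<le> K" using K[of z g] z r order_trans[OF norm_ge_zero] by simp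
  \<comment> \<open>The almost minimisers of \<open>\<Phi> - z\<close>, up to
    \<open>1 / Suc n\<close>, that satisfy the norm bound and violate the claim.\<close>
  define S where "S n = {f\<in>D. \<phi> f \<le> \<phi> g + z \<bullet> (f - g) + 1 / Suc n} \<inter> (cball 0 K \<inter> {f. h \<bullet> g + \<delta> \<le> h \<bullet> f})" for n
  have "\<exists>n. S n = {}"
  proof (rule ccontr)
    assume ne: "\<nexists>n. S n = {}"
    have "(\<Inter>n. S n) \<noteq> {}"
    proof (rule Inter_closed_convex_bounded_nonempty)
      show "closed (S n)" for n
        unfolding S_def
        by (intro closed_Int closed_sublevel closed_cball closed_halfspace_ge continuous_intros)
      show "convex (S n)" for n
      proof -
        from convex_sublevel[OF convex_on_tilted, of z "\<phi> g - z \<bullet> g + 1 / Suc n"]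
        have "convex {f\<in>D. \<phi> f \<le> \<phi> g + z \<bullet> (f - g) + 1 / Suc n}"
          by (rule back_subst[where P = convex]) (auto simp: inner_simps)
        then show ?thesis
          unfolding S_def by (intro convex_Int convex_cball convex_halfspace_ge)
      qed
      show "decseq S"
      proof -
        have "1 / (1 + real m) \<le> 1 / (1 + real n)" if "n \<le> m" for n m
          using that by (intro divide_left_mono) auto
        then show ?thesis by (force simp: S_def decseq_def)
      qed
      show "bounded (S 0)" unfolding S_def by (intro bounded_Int disjI2 disjI1 bounded_cball)
    qed (use ne in blast)
    then obtain f where fS: "\<And>n. f \<in> S n" by auto
    then have f: "f \<in> D" "h \<bullet> g + \<delta> \<le> h \<bullet> f"
      and fn: "\<And>n. \<phi> f \<le> \<phi> g + z \<bullet> (f - g) + 1 / Suc n"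
      by (auto simp: S_def)
    have "\<phi> f \<le> \<phi> g + z \<bullet> (f - g)"
    proof (rule LIMSEQ_le_const)
      show "(\<lambda>n. \<phi> g + z \<bullet> (f - g) + 1 / Suc n) \<longlonglongrightarrow> \<phi> g + z \<bullet> (f - g)"
        using tendsto_add[OF tendsto_const LIMSEQ_Suc[OF lim_1_over_n]] by force
    qed (use fn in auto)
    then have "z \<in> subdifferential \<Phi> f"
      using f(1) zg by (force simp: subdifferential_iff inner_simps)
    from uniq[OF this] f(2) \<delta> show False by simp
  qed
  then obtain n where n: "S n = {}" by blast
  \<comment> \<open>\<open>L\<close> dominates \<open>norm (p - g)\<close>, and the added
    \<open>1\<close> keeps it positive. Then \<open>\<eta>\<close> makes
    \<open>(u - z) \<bullet> (p - g)\<close> at most \<open>1 / Suc n\<close>, the tolerance of the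
    empty set \<open>S n\<close>.\<close>
  define L where "L = K + norm g + 1"
  have L: "L > 0" using \<open>0 \<le> K\<close> norm_ge_zero[of g] unfolding L_def by linarith
  define \<eta> where "\<eta> = min r (1 / (Suc n * L))"
  have "\<eta> > 0" using r L by (simp add: \<eta>_def)
  moreover have "h \<bullet> (p - g) < \<delta>" if u: "norm (u - z) < \<eta>" "u \<in> subdifferential \<Phi> p" for u p
  proof (rule ccontr)
    assume "\<not> h \<bullet> (p - g) < \<delta>"
    then have h: "h \<bullet> g + \<delta> \<le> h \<bullet> p" by (simp add: inner_simps)
    have pK: "norm p \<le> K" using u by (intro K[of u p]) (auto simp: \<eta>_def)
    have "(u - z) \<bullet> (p - g) \<le> norm (u - z) * norm (p - g)" by (rule norm_cauchy_schwarz)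
    also have "\<dots> \<le> 1 / (Suc n * L) * L"
      using u(1) pK norm_triangle_ineq4[of p g] L
      by (intro mult_mono) (auto simp: \<eta>_def L_def)
    also have "\<dots> = 1 / Suc n" using L by simp
    finally have "(u - z) \<bullet> (p - g) \<le> 1 / Suc n" .
    moreover have "p \<in> D" "\<phi> p + u \<bullet> (g - p) \<le> \<phi> g"
      using u(2) g by (auto simp: subdifferential_iff)
    ultimately have "p \<in> S n"
      using h pK by (simp add: S_def inner_simps)
    with n show False by blast
  qed
  ultimately show ?thesis by (rule that)
qed

lemma has_gateaux_gradient_conjugate:
  assumes lb: "sv_locally_bounded (sv_inverse (subdifferential \<Phi>))"
    and z: "z \<in> subdifferential \<Phi> g"
    and uniq: "\<And>f. z \<in> subdifferential \<Phi> f \<Longrightarrow> f = g"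
  shows "has_gateaux_gradient (convex_conjugate \<Phi>) z g"
proof -
  have g: "g \<in> D" using z by (simp add: subdifferential_iff)
  have "z \<in> sv_dom (sv_inverse (subdifferential \<Phi>))"
    using z by (auto simp: sv_dom_def sv_inverse_def)
  then obtain r where r: "r > 0" "bounded (\<Union>u\<in>ball z r. sv_inverse (subdifferential \<Phi>) u)"
    using lb unfolding sv_locally_bounded_def by blast
  then obtain K where "\<And>f. f \<in> (\<Union>u\<in>ball z r. sv_inverse (subdifferential \<Phi>) u) \<Longrightarrow> norm f \<le> K"
    by (auto simp: bounded_iff)
  then have K: "norm f \<le> K" if "norm (u - z) < r" "u \<in> subdifferential \<Phi> f" for u f
    using that by (force simp: sv_inverse_def dist_norm norm_minus_commute)
  define C where "C = r * K + z \<bullet> g - \<phi> g"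
  have C: "u \<bullet> f - \<phi> f \<le> C" if "norm (u - z) < r / 2" "f \<in> D" for u f
    unfolding C_def using affine_bound_near_subgradient[OF z K that] .
  define \<psi> where "\<psi> u = real_of_ereal (convex_conjugate \<Phi> u)" for u
  have fin: "\<bar>convex_conjugate \<Phi> u\<bar> \<noteq> \<infinity>" and \<psi>_ge: "\<And>f. f \<in> D \<Longrightarrow> u \<bullet> f - \<phi> f \<le> \<psi> u"
    if u: "norm (u - z) < r / 2" for u
  proof -
    have "convex_conjugate \<Phi> u \<le> ereal C" by (rule conjugate_le) (rule C[OF u])
    moreover note conjugate_ge[OF g, of u]
    ultimately show fin: "\<bar>convex_conjugate \<Phi> u\<bar> \<noteq> \<infinity>"
      by (cases "convex_conjugate \<Phi> u") auto
    show "u \<bullet> f - \<phi> f \<le> \<psi> u" if "f \<in> D" for f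
      using conjugate_ge[OF that, of u] fin unfolding \<psi>_def
      by (cases "convex_conjugate \<Phi> u") auto
  qed
  have \<psi>_eq: "\<psi> u = u \<bullet> p - \<phi> p" if "u \<in> subdifferential \<Phi> p" for u p
    using conjugate_eq[OF that] by (simp add: \<psi>_def)
  have "ball z (r / 2) \<subseteq> {u. \<bar>convex_conjugate \<Phi> u\<bar> \<noteq> \<infinity>}"
    using fin by (intro subsetI CollectI) (simp add: dist_norm norm_minus_commute)
  then have int: "z \<in> interior {u. \<bar>convex_conjugate \<Phi> u\<bar> \<noteq> \<infinity>}"
    using r(1) by (auto simp: mem_interior intro!: exI[of _ "r / 2"])
  have "((\<lambda>t. \<psi> (z + t *\<^sub>R h)) has_real_derivative (g \<bullet> h)) (at 0)" for h
    unfolding DERIV_def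
  proof (rule LIM_I)
    fix \<delta> :: real assume \<delta>: "0 < \<delta>"
    \<comment> \<open>The weak continuity is one-sided, so \<open>h\<close> and \<open>- h\<close>
      together bound the absolute value.\<close>
    obtain \<eta>1 where \<eta>1: "\<eta>1 > 0"
      "\<And>u p. norm (u - z) < \<eta>1 \<Longrightarrow> u \<in> subdifferential \<Phi> p \<Longrightarrow> h \<bullet> (p - g) < \<delta>"
      by (rule subgradient_inverse_weakly_continuous[OF z uniq r(1) K \<delta>, where h = h])
        (assumption | rule that)+
    obtain \<eta>2 where \<eta>2: "\<eta>2 > 0"
      "\<And>u p. norm (u - z) < \<eta>2 \<Longrightarrow> u \<in> subdifferential \<Phi> p \<Longrightarrow> (- h) \<bullet> (p - g) < \<delta>"
      by (rule subgradient_inverse_weakly_continuous[OF z uniq r(1) K \<delta>, where h = "- h"])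
        (assumption | rule that)+
    \<comment> \<open>The bound \<open>C\<close> holds within \<open>r / 2\<close> of
      \<open>z\<close>, and solvability of \<open>u \<in> subdifferential \<Phi> p\<close> costs
      another factor two.\<close>
    define \<eta> where "\<eta> = min (r / 4) (min \<eta>1 \<eta>2)"
    define s where "s = \<eta> / (norm h + 1)"
    have h1: "norm h + 1 > 0" using norm_ge_zero[of h] by linarith
    have "\<eta> > 0" using r(1) \<eta>1(1) \<eta>2(1) by (simp add: \<eta>_def)
    then have s: "s > 0" using h1 by (simp add: s_def)
    show "\<exists>s>0. \<forall>x. x \<noteq> 0 \<and> norm (x - 0) < s \<longrightarrow>
        norm ((\<psi> (z + (0 + x) *\<^sub>R h) - \<psi> (z + 0 *\<^sub>R h)) / x - g \<bullet> h) < \<delta>"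
    proof (intro exI[of _ s] conjI allI impI s)
      fix t :: real assume t: "t \<noteq> 0 \<and> norm (t - 0) < s"
      define u where "u = z + t *\<^sub>R h"
      have "norm (u - z) \<le> \<bar>t\<bar> * (norm h + 1)"
        by (simp add: u_def mult_left_mono)
      also have "\<dots> < \<eta>" using t h1 by (simp add: s_def field_simps)
      finally have u: "norm (u - z) < \<eta>" .
      then have u4: "norm (u - z) < (r / 2) / 2" and u2: "norm (u - z) < r / 2"
        using r(1) by (auto simp: \<eta>_def)
      obtain p where p: "u \<in> subdifferential \<Phi> p"
        using subgradient_range_near[OF _ _ C u4] r(1) g by auto
      have pD: "p \<in> D" using p by (simp add: subdifferential_iff)
      have "h \<bullet> (p - g) < \<delta>" "(- h) \<bullet> (p - g) < \<delta>"
        using \<eta>1(2)[OF _ p] \<eta>2(2)[OF _ p] u by (auto simp: \<eta>_def)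
      then have small: "\<bar>h \<bullet> (p - g)\<bar> < \<delta>" by auto
      \<comment> \<open>The sandwich comes from testing the conjugate at \<open>u\<close> with
        \<open>g\<close>, and the conjugate at \<open>z\<close> with \<open>p\<close>. It holds for
        either sign of \<open>t\<close>.\<close>
      have lower: "0 \<le> \<psi> u - \<psi> z - t * (g \<bullet> h)"
        using \<psi>_ge[OF u2 g] \<psi>_eq[OF z] by (simp add: u_def inner_simps inner_commute)
      have upper: "\<psi> u - \<psi> z - t * (g \<bullet> h) \<le> t * (h \<bullet> (p - g))"
        using \<psi>_ge[of z p] pD r(1) \<psi>_eq[OF p]
        by (simp add: u_def inner_simps inner_commute algebra_simps)
      have "\<bar>\<psi> u - \<psi> z - t * (g \<bullet> h)\<bar> \<le> \<bar>t\<bar> * \<bar>h \<bullet> (p - g)\<bar>"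
        using lower upper unfolding abs_mult[symmetric] by linarith
      also have "\<dots> < \<bar>t\<bar> * \<delta>" using small t by simp
      finally have "\<bar>\<psi> u - \<psi> z - t * (g \<bullet> h)\<bar> / \<bar>t\<bar> < \<delta>"
        using t by (simp add: field_simps)
      moreover have "(\<psi> u - \<psi> z) / t - g \<bullet> h = (\<psi> u - \<psi> z - t * (g \<bullet> h)) / t"
        using t by (simp add: field_simps)
      ultimately show "norm ((\<psi> (z + (0 + t) *\<^sub>R h) - \<psi> (z + 0 *\<^sub>R h)) / t - g \<bullet> h) < \<delta>"
        by (simp add: u_def abs_divide)
    qed
  qed
  then show ?thesis
    using int by (simp add: has_gateaux_gradient_def \<psi>_def)
qed

end

section \<open>Expected Bregman divergence\<close>

text \<open>The two integrands differ by an integrable function with mean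
  \<open>bregman \<Phi> f g\<close>. Hence both expectations are finite or both are infinite, and
  the identity holds in either case.\<close>

lemma expected_bregman_eq_plus:
  fixes \<Phi> :: "'a::{real_inner, banach, second_countable_topology} \<Rightarrow> ereal"
    and F :: "'w \<Rightarrow> 'a" and M :: "'w measure"
  assumes gen: "generator \<Phi>" and M: "prob_space M"
    and F [measurable]: "F \<in> borel_measurable M"
    and FA: "AE \<omega> in M. F \<omega> \<in> interior (dom_fun \<Phi>)"
    and Z: "integrable M (\<lambda>\<omega>. grad \<Phi> (F \<omega>))"
    and mean: "grad \<Phi> g = (\<integral>\<omega>. grad \<Phi> (F \<omega>) \<partial>M)"
    and g: "g \<in> interior (dom_fun \<Phi>)" and f: "f \<in> dom_fun \<Phi>"
  shows "expected_bregman M \<Phi> F f = expected_bregman M \<Phi> F g + ennreal (bregman \<Phi> f g)"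
proof -
  interpret generator_function \<Phi> using gen by unfold_locales
  interpret prob_space M by (rule M)
  have gD: "g \<in> D" using g interior_subset by blast
  have [measurable]: "\<Phi> \<in> borel_measurable borel"
    using gen by (simp add: generator_def borel_measurable_lower_semicontinuous)
  have Zm [measurable]: "(\<lambda>\<omega>. grad \<Phi> (F \<omega>)) \<in> borel_measurable M"
    using Z by (rule borel_measurable_integrable)
  have meas [measurable]: "(\<lambda>\<omega>. bregman \<Phi> x (F \<omega>)) \<in> borel_measurable M" for x
    unfolding bregman_def by measurable
  have nonneg: "AE \<omega> in M. 0 \<le> bregman \<Phi> x (F \<omega>)" if "x \<in> D" for x
    using FA by eventually_elim (rule bregman_nonneg[OF _ that])
  \<comment> \<open>The values \<open>\<phi> (F \<omega>)\<close> cancel in the difference. What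
    remains is affine in \<open>grad \<Phi> (F \<omega>)\<close>, so Bochner integrability suffices
    and \<open>mean\<close> evaluates the integral.\<close>
  define c where "c \<omega> = \<phi> f - \<phi> g - grad \<Phi> (F \<omega>) \<bullet> (f - g)" for \<omega>
  have int_c: "integrable M c" and c_mean: "(\<integral>\<omega>. c \<omega> \<partial>M) = bregman \<Phi> f g"
    using Z by (simp_all add: c_def[abs_def] bregman_def mean prob_space)
  have split: "bregman \<Phi> f (F \<omega>) = bregman \<Phi> g (F \<omega>) + c \<omega>" for \<omega>
    by (simp add: c_def bregman_def inner_simps)
  have eq: "expected_bregman M \<Phi> F x = ennreal (\<integral>\<omega>. bregman \<Phi> x (F \<omega>) \<partial>M)"
    if "integrable M (\<lambda>\<omega>. bregman \<Phi> x (F \<omega>))" "x \<in> D" for x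
    unfolding expected_bregman_def using that nonneg by (intro nn_integral_eq_integral)
  have top: "expected_bregman M \<Phi> F x = \<infinity>"
    if "\<not> integrable M (\<lambda>\<omega>. bregman \<Phi> x (F \<omega>))" "x \<in> D" for x
    using integrableI_nonneg[OF meas nonneg[OF that(2)]] that(1)
    unfolding expected_bregman_def by (metis infinity_ennreal_def top.not_eq_extremum)
  show ?thesis
  proof (cases "integrable M (\<lambda>\<omega>. bregman \<Phi> g (F \<omega>))")
    case True
    then have "integrable M (\<lambda>\<omega>. bregman \<Phi> f (F \<omega>))"
      unfolding split using int_c by simp
    moreover have "(\<integral>\<omega>. bregman \<Phi> f (F \<omega>) \<partial>M) = (\<integral>\<omega>. bregman \<Phi> g (F \<omega>) \<partial>M) + bregman \<Phi> f g"
      unfolding split c_mean[symmetric] using True int_c by simp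
    moreover have "0 \<le> (\<integral>\<omega>. bregman \<Phi> g (F \<omega>) \<partial>M)"
      using nonneg[OF gD] by (rule integral_nonneg_AE)
    ultimately show ?thesis
      using eq True f gD bregman_nonneg[OF g f] by (simp add: ennreal_plus)
  next
    case False
    have "\<not> integrable M (\<lambda>\<omega>. bregman \<Phi> f (F \<omega>))"
    proof
      assume "integrable M (\<lambda>\<omega>. bregman \<Phi> f (F \<omega>))"
      then have "integrable M (\<lambda>\<omega>. bregman \<Phi> f (F \<omega>) - c \<omega>)" using int_c by simp
      then show False using False by (simp add: split)
    qed
    then show ?thesis using top False f gD by simp
  qed
qed

text \<open>Expectations are taken in \<open>[0, \<infinity>]\<close>; were they infinite throughout
  \<open>U\<close>, every point of \<open>U\<close> would be a minimiser, so uniqueness is stated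
  under finiteness somewhere. As \<open>grad\<close> refers to the Frechet derivative, its value for
  the conjugate is asserted where that derivative exists, next to the unconditional Gateaux
  gradient.\<close>

theorem theorem11:
  fixes \<Phi> :: "'a::{real_inner, banach, second_countable_topology} \<Rightarrow> ereal"
    and U V A :: "'a set"
    and M :: "'w measure"
    and F :: "'w \<Rightarrow> 'a"
    and zbar :: 'a
  assumes legendre: "legendre_generator \<Phi>"
    and A: "A = interior (dom_fun \<Phi>)"
    and U: "U \<subseteq> A" "U \<noteq> {}" "open U" "convex U"
    and V: "V = grad \<Phi> ` U"
    and M: "prob_space M"
    and F: "F \<in> borel_measurable M" "\<P>(\<omega> in M. F \<omega> \<in> U) = 1"
    and Z: "integrable M (\<lambda>\<omega>. grad \<Phi> (F \<omega>))"
    and zbar: "zbar = (\<integral>\<omega>. grad \<Phi> (F \<omega>) \<partial>M)" "zbar \<in> V"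
  shows "inj_on (grad \<Phi>) A \<and>
    (\<exists>gstar\<in>U.
       has_gateaux_gradient (convex_conjugate \<Phi>) zbar gstar \<and>
       ((\<lambda>u. real_of_ereal (convex_conjugate \<Phi> u)) differentiable (at zbar) \<longrightarrow>
          grad (convex_conjugate \<Phi>) zbar = gstar) \<and>
       gstar = the_inv_into A (grad \<Phi>) zbar \<and>
       gstar = quasi_arithmetic_mean M A (grad \<Phi>) F \<and>
       is_arg_min (expected_bregman M \<Phi> F) (\<lambda>g. g \<in> U) gstar \<and>
       ((\<exists>g\<in>U. expected_bregman M \<Phi> F g < \<infinity>) \<longrightarrow>
          (\<forall>g. is_arg_min (expected_bregman M \<Phi> F) (\<lambda>g. g \<in> U) g \<longrightarrow> g = gstar)))"
proof -
  interpret generator_function \<Phi>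
    using legendre by unfold_locales (simp add: legendre_generator_def)
  interpret prob_space M by (rule M)
  obtain g where g: "g \<in> U" "zbar = grad \<Phi> g" using zbar(2) V by blast
  have gA: "g \<in> interior D" using g(1) U(1) A by blast
  have inj: "inj_on (grad \<Phi>) A" using inj_on_grad A by simp
  have inv: "the_inv_into A (grad \<Phi>) zbar = g"
    using the_inv_into_f_f[OF inj] gA A g(2) by simp
  have gat: "has_gateaux_gradient (convex_conjugate \<Phi>) zbar g"
    unfolding g(2)
  proof (rule has_gateaux_gradient_conjugate)
    show "sv_locally_bounded (sv_inverse (subdifferential \<Phi>))"
      using legendre by (simp add: legendre_generator_def essentially_strictly_convex_def)
    show "grad \<Phi> g \<in> subdifferential \<Phi> g" by (rule grad_in_subdifferential[OF gA])
    show "f = g" if "grad \<Phi> g \<in> subdifferential \<Phi> f" for f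
      using gA that by (rule grad_in_subdifferential_imp_eq)
  qed
  have "{\<omega> \<in> space M. F \<omega> \<in> U} \<in> sets M"
    using measurable_sets[OF F(1) borel_open[OF U(3)]] by (simp add: vimage_def Int_def conj_commute)
  then have FU: "AE \<omega> in M. F \<omega> \<in> U" using F(2) by (subst (asm) prob_Collect_eq_1)
  then have FA: "AE \<omega> in M. F \<omega> \<in> interior D"
    by eventually_elim (use U(1) A in blast)
  have plus: "expected_bregman M \<Phi> F f = expected_bregman M \<Phi> F g + ennreal (bregman \<Phi> f g)"
    if "f \<in> U" for f
  proof (rule expected_bregman_eq_plus[OF generator M F(1) FA Z _ gA])
    show "grad \<Phi> g = (\<integral>\<omega>. grad \<Phi> (F \<omega>) \<partial>M)" using g(2) zbar(1) by simp
    show "f \<in> D" using that U(1) A interior_subset by blast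
  qed
  have min: "is_arg_min (expected_bregman M \<Phi> F) (\<lambda>g. g \<in> U) g"
    unfolding is_arg_min_def
  proof (intro conjI notI g(1))
    assume "\<exists>f. f \<in> U \<and> expected_bregman M \<Phi> F f < expected_bregman M \<Phi> F g"
    then obtain f where "f \<in> U" "expected_bregman M \<Phi> F f < expected_bregman M \<Phi> F g" by blast
    then show False by (simp add: plus)
  qed
  have uniq: "f = g" if fin: "\<exists>g\<in>U. expected_bregman M \<Phi> F g < \<infinity>"
    and f: "is_arg_min (expected_bregman M \<Phi> F) (\<lambda>g. g \<in> U) f" for f
  proof (rule ccontr)
    assume "f \<noteq> g"
    have fU: "f \<in> U" using f by (simp add: is_arg_min_def)
    then have "f \<in> D" using U(1) A interior_subset by blast
    then have pos: "0 < bregman \<Phi> f g" using bregman_pos[OF gA] \<open>f \<noteq> g\<close> by simp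
    \<comment> \<open>Finiteness at any \<open>f'\<close> passes to \<open>g\<close> through
      \<open>plus\<close>; strict cancellation in \<open>ennreal\<close> requires it.\<close>
    obtain f' where "f' \<in> U" "expected_bregman M \<Phi> F f' < \<infinity>" using fin by blast
    then have "expected_bregman M \<Phi> F g < \<infinity>" using plus[of f'] by (simp add: less_top)
    then have "expected_bregman M \<Phi> F g < expected_bregman M \<Phi> F f"
      unfolding plus[OF fU] using pos ennreal_add_left_cancel_less[of "expected_bregman M \<Phi> F g" 0]
      by (simp add: less_top)
    then show False using f g(1) unfolding is_arg_min_def by blast
  qed
  have qam: "quasi_arithmetic_mean M A (grad \<Phi>) F = g"
    unfolding quasi_arithmetic_mean_def zbar(1)[symmetric] by (rule inv)
  show ?thesis
  proof (intro conjI bexI[OF _ g(1)] impI allI)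
    show "grad (convex_conjugate \<Phi>) zbar = g"
      if "(\<lambda>u. real_of_ereal (convex_conjugate \<Phi> u)) differentiable (at zbar)"
      using gat that by (rule grad_eq_gateaux_gradient)
    show "f = g" if "\<exists>g\<in>U. expected_bregman M \<Phi> F g < \<infinity>"
      and "is_arg_min (expected_bregman M \<Phi> F) (\<lambda>g. g \<in> U) f" for f
      using that by (rule uniq)
  qed (rule inj gat min inv[symmetric] qam[symmetric])+
qed

end
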